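(* Let $\mathsf{E}$ and $\mathsf{F}$ be Fréchet spaces over $\mathbb{R}$. Let $F\colon\mathsf{E}\to\mathbb{R}$ be a Keller $C^1_c$-functional that satisfies the Palais--Smale condition, and let $L\colon\mathsf{E}\to\mathsf{F}$ be a linear Keller $C^1_c$-homeomorphism. Then the functional $G\colon\mathsf{F}\to\mathbb{R}$ defined by $G(y):=F(L^{-1}(y))$ also satisfies the Palais--Smale condition.
   Context: For Fréchet spaces $\mathsf{E},\mathsf{F}$, $\mathcal{L}_c(\mathsf{E},\mathsf{F})$ is the space of continuous linear maps $\mathsf{E}\to\mathsf{F}$ with the topology of compact convergence, defined by the seminorms $\ell\mapsto\sup_{h\in S}\|\ell(h)\|_{\mathsf{F},i}$, with $S\subset\mathsf{E}$ compact and $\|\cdot\|_{\mathsf{F},i}$ ranging over an increasing sequence of continuous seminorms defining the topology of $\mathsf{F}$. Write $\mathsf{E}'_c=\mathcal{L}_c(\mathsf{E},\mathbb{R})$. For $U\subseteq\mathsf{E}$ open and $\varphi\colon U\to\mathsf{F}$, $\mathrm{D}\varphi(x)(h):=\lim_{t\to0}\frac1t(\varphi(x+th)-\varphi(x))$ when it exists; $\varphi$ is differentiable at $x$ if this exists for all $h\in\mathsf{E}$. $\varphi$ is a Keller $C^1_c$-mapping if it is differentiable at all points of $U$, each $\mathrm{D}\varphi(x)$ is a continuous linear map, and $\mathrm{D}\varphi\colon U\to\mathcal{L}_c(\mathsf{E},\mathsf{F})$ is continuous. A Keller $C^1_c$-functional is a real-valued Keller $C^1_c$-mapping. A linear Keller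 $C^1_c$-homeomorphism is a linear homeomorphism of $\mathsf{E}$ onto $\mathsf{F}$ (a linear homeomorphism and its inverse are automatically Keller $C^1_c$). A Keller $C^1_c$-functional $\varphi\colon\mathsf{E}\to\mathbb{R}$ satisfies the Palais--Smale condition if every sequence $(x_i)\subset\mathsf{E}$ such that $(\varphi(x_i))$ is bounded and $\mathrm{D}\varphi(x_i)\to0$ in $\mathsf{E}'_c$ has a convergent subsequence in $\mathsf{E}$. *)

theory Defs
  imports "HOL-Analysis.Analysis"
begin

subsection \<open>Frechet spaces\<close>

definition (in real_vector) seminorm :: "('a \<Rightarrow> real) \<Rightarrow> bool" where
  "seminorm p \<longleftrightarrow>
     (\<forall>x y. p (x + y) \<le> p x + p y) \<and> (\<forall>c x. p (c *\<^sub>R x) = \<bar>c\<bar> * p x)"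

class real_vector_t2_space = real_vector + t2_space

definition (in real_vector_t2_space) defining_seminorms :: "(nat \<Rightarrow> 'a \<Rightarrow> real) \<Rightarrow> bool" where
  "defining_seminorms p \<longleftrightarrow>
     (\<forall>i. seminorm (p i)) \<and> incseq p \<and>
     (\<forall>U. open U \<longleftrightarrow> (\<forall>x\<in>U. \<exists>i. \<exists>e>0. {y. p i (y - x) < e} \<subseteq> U))"

text \<open>Only the existence of a defining sequence of seminorms is required, so that no sequence
  is part of the structure. Since the topology is metrizable by a translation-invariant metric,
  completeness may be expressed by sequences that are Cauchy for the additive uniformity.\<close>

class frechet_space = real_vector_t2_space +
  assumes ex_defining_seminorms: "\<exists>p. defining_seminorms p"
    and additive_Cauchy_convergent:
      "(\<And>U. open U \<Longrightarrow> 0 \<in> U \<Longrightarrow> \<exists>N. \<forall>i\<ge>N. \<forall>j\<ge>N. X i - X j \<in> U) \<Longrightarrow> convergent X"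

instance real_normed_vector \<subseteq> real_vector_t2_space ..

lemma defining_seminorms_norm:
  "defining_seminorms (\<lambda>_. norm :: 'a::real_normed_vector \<Rightarrow> real)"
  by (auto simp: defining_seminorms_def seminorm_def norm_triangle_ineq incseq_def
      open_dist dist_norm subset_eq)

instance banach \<subseteq> frechet_space
proof
  show "\<exists>p. defining_seminorms (p :: nat \<Rightarrow> 'a \<Rightarrow> real)"
    using defining_seminorms_norm by blast
  fix X :: "nat \<Rightarrow> 'a"
  assume *: "\<And>U. open U \<Longrightarrow> 0 \<in> U \<Longrightarrow> \<exists>N. \<forall>i\<ge>N. \<forall>j\<ge>N. X i - X j \<in> U"
  have "Cauchy X"
  proof (rule CauchyI)
    fix e :: real assume "e > 0"
    then show "\<exists>M. \<forall>m\<ge>M. \<forall>n\<ge>M. norm (X m - X n) < e"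
      using *[of "ball 0 e"] by auto
  qed
  then show "convergent X" by (rule Cauchy_convergent)
qed

subsection \<open>The topology of compact convergence\<close>

definition Lc_space :: "('a::frechet_space \<Rightarrow> 'b::frechet_space) set" where
  "Lc_space = {l. linear l \<and> continuous_on UNIV l}"

text \<open>The locally convex topology on \<^const>\<open>Lc_space\<close> defined by the seminorms
  \<open>l \<mapsto> sup {p i (l h) | h \<in> S}\<close> with \<open>S\<close> compact; empty \<open>S\<close> is excluded because the supremum
  of the empty set of reals is unspecified.\<close>

definition Lc_ball ::
    "('b \<Rightarrow> real) \<Rightarrow> 'a set \<Rightarrow> ('a \<Rightarrow> 'b) \<Rightarrow> real \<Rightarrow> ('a::frechet_space \<Rightarrow> 'b::frechet_space) set"
  where "Lc_ball q S l e = {m \<in> Lc_space. (SUP h\<in>S. q (m h - l h)) < e}"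

definition Lc_topology_wrt ::
    "(nat \<Rightarrow> 'b \<Rightarrow> real) \<Rightarrow> ('a::frechet_space \<Rightarrow> 'b::frechet_space) topology" where
  "Lc_topology_wrt p = topology_generated_by
     {Lc_ball (p i) S l e | i S l e. compact S \<and> S \<noteq> {} \<and> l \<in> Lc_space \<and> e > 0}"

text \<open>The choice of the defining sequence is immaterial; see \<open>Lc_topology_eq\<close> below.\<close>

definition Lc_topology :: "('a::frechet_space \<Rightarrow> 'b::frechet_space) topology" where
  "Lc_topology = Lc_topology_wrt (SOME p. defining_seminorms p)"

lemma seminorm_zero: "seminorm p \<Longrightarrow> p 0 = 0"
  unfolding seminorm_def by (metis abs_zero mult_zero_left scaleR_zero_left)

lemma seminorm_minus: "seminorm p \<Longrightarrow> p (- x) = p x"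
  unfolding seminorm_def by (metis abs_minus_cancel abs_one mult_1 scaleR_minus1_left)

lemma seminorm_triangle_diff: "seminorm p \<Longrightarrow> p (x - z) \<le> p (x - y) + p (y - z)"
  unfolding seminorm_def by (metis diff_add_cancel add_diff_eq)

lemma seminorm_diff_le: "seminorm p \<Longrightarrow> p (x - y) \<le> p x + p y"
  by (metis diff_conv_add_uminus seminorm_def seminorm_minus)

lemma defining_seminorms_open_ball:
  assumes "defining_seminorms p"
  shows "open {y. p i (y - x) < e}"
proof -
  have s: "seminorm (p i)" using assms by (simp add: defining_seminorms_def)
  have "\<exists>j. \<exists>d>0. {z. p j (z - y) < d} \<subseteq> {y. p i (y - x) < e}" if "p i (y - x) < e" for y
  proof (intro exI conjI)
    show "e - p i (y - x) > 0" using that by simp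
    show "{z. p i (z - y) < e - p i (y - x)} \<subseteq> {y. p i (y - x) < e}"
    proof clarify
      fix z assume "p i (z - y) < e - p i (y - x)"
      then show "p i (z - x) < e" using seminorm_triangle_diff[OF s, of z x y] by linarith
    qed
  qed
  then show ?thesis using assms unfolding defining_seminorms_def by blast
qed

lemma defining_seminorms_continuous:
  assumes "defining_seminorms p"
  shows "continuous_on UNIV (p i)"
proof -
  have s: "seminorm (p i)" using assms by (simp add: defining_seminorms_def)
  have "(p i \<longlongrightarrow> p i x) (nhds x)" for x
  proof (rule tendstoI)
    fix e :: real assume e: "e > 0"
    have "dist (p i y) (p i x) < e" if "p i (y - x) < e" for y
    proof -
      have "p i (x - y) = p i (y - x)" by (metis minus_diff_eq s seminorm_minus)
      then show ?thesis
        using that seminorm_triangle_diff[OF s, of y 0 x] seminorm_triangle_diff[OF s, of x 0 y]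
        by (simp add: dist_real_def abs_less_iff)
    qed
    moreover have "\<forall>\<^sub>F y in nhds x. y \<in> {y. p i (y - x) < e}"
      by (rule eventually_nhds_in_open)
        (use e seminorm_zero[OF s] defining_seminorms_open_ball[OF assms] in auto)
    ultimately show "\<forall>\<^sub>F y in nhds x. dist (p i y) (p i x) < e"
      by (auto elim: eventually_mono)
  qed
  then show ?thesis
    unfolding continuous_on_def by (metis tendsto_mono at_within_le_nhds)
qed

lemma defining_seminorms_dominated:
  assumes p: "defining_seminorms p" and q: "defining_seminorms q"
  obtains j C where "C > 0" "\<And>x. q i x \<le> C * p j x"
proof -
  have sq: "seminorm (q i)" and sp: "\<And>j. seminorm (p j)"
    using p q by (auto simp: defining_seminorms_def)
  have "open {y. q i (y - 0) < 1}" by (rule defining_seminorms_open_ball[OF q])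
  moreover have "0 \<in> {y. q i (y - 0) < 1}" using seminorm_zero[OF sq] by simp
  ultimately obtain j e where e: "e > 0" "{y. p j (y - 0) < e} \<subseteq> {y. q i (y - 0) < 1}"
    using p unfolding defining_seminorms_def by blast
  have "q i x \<le> (1 / e) * p j x" for x
  proof (rule field_le_epsilon)
    fix d :: real assume d: "d > 0"
    have "0 \<le> p j x"
      using seminorm_diff_le[OF sp, of j x x] seminorm_zero[OF sp, of j] by simp
    define s where "s = p j x + e * d"
    have s: "s > 0" "p j x < s" using \<open>0 \<le> p j x\<close> d e(1) by (auto simp: s_def add_nonneg_pos)
    have "p j ((e / s) *\<^sub>R x) = (e / s) * p j x" using sp s e(1) by (simp add: seminorm_def)
    also have "\<dots> < e" using s e(1) by (simp add: field_simps)
    finally have "q i ((e / s) *\<^sub>R x) < 1" using e(2) by auto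
    then have "(e / s) * q i x < 1" using sq s e(1) by (simp add: seminorm_def)
    then show "q i x \<le> (1 / e) * p j x + d" using s e(1) by (simp add: field_simps s_def)
  qed
  moreover have "1 / e > 0" using e(1) by simp
  ultimately show thesis using that by blast
qed

lemma Lc_space_bdd_above:
  assumes p: "defining_seminorms p" and l: "l \<in> Lc_space" and m: "m \<in> Lc_space"
    and S: "compact S"
  shows "bdd_above ((\<lambda>h. p i (m h - l h)) ` S)"
proof -
  have b: "bdd_above ((\<lambda>h. p i (k h)) ` S)" if "k \<in> Lc_space" for k
  proof -
    have "continuous_on S k" using that by (auto simp: Lc_space_def intro: continuous_on_subset)
    then have "compact (p i ` k ` S)"
      using S defining_seminorms_continuous[OF p]
      by (meson compact_continuous_image continuous_on_subset subset_UNIV)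
    then show ?thesis by (simp add: image_image bounded_imp_bdd_above compact_imp_bounded)
  qed
  obtain A B where A: "\<And>h. h \<in> S \<Longrightarrow> p i (m h) \<le> A" and B: "\<And>h. h \<in> S \<Longrightarrow> p i (l h) \<le> B"
    using b[OF l] b[OF m] by (auto simp: bdd_above_def)
  have "p i (m h - l h) \<le> A + B" if "h \<in> S" for h
    using A[OF that] B[OF that] seminorm_diff_le[of "p i" "m h" "l h"] p
    by (simp add: defining_seminorms_def)
  then show ?thesis by (auto intro!: bdd_aboveI)
qed

lemma openin_Lc_ball:
  assumes p: "defining_seminorms p" and q: "defining_seminorms q"
    and S: "compact S" "S \<noteq> {}" and l: "l \<in> Lc_space"
  shows "openin (Lc_topology_wrt p) (Lc_ball (q i) S l e)"
proof (subst openin_subopen, intro ballI)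
  fix m assume m: "m \<in> Lc_ball (q i) S l e"
  have sq: "seminorm (q i)" and sp: "\<And>j. seminorm (p j)"
    using p q by (auto simp: defining_seminorms_def)
  obtain j C where C: "C > 0" "\<And>x. q i x \<le> C * p j x"
    using defining_seminorms_dominated[OF p q] by blast
  define r where "r = (SUP h\<in>S. q i (m h - l h))"
  define d where "d = (e - r) / (2 * C)"
  have mL: "m \<in> Lc_space" and "r < e" using m by (auto simp: Lc_ball_def r_def)
  then have d: "d > 0" using C by (simp add: d_def)
  have "m \<in> Lc_ball (p j) S m d"
    using mL d S(2) seminorm_zero[OF sp] by (simp add: Lc_ball_def)
  moreover have "openin (Lc_topology_wrt p) (Lc_ball (p j) S m d)"
    unfolding Lc_topology_wrt_def
    by (rule topology_generated_by_Basis) (use mL d S in blast)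
  moreover have "Lc_ball (p j) S m d \<subseteq> Lc_ball (q i) S l e"
  proof
    fix k assume k: "k \<in> Lc_ball (p j) S m d"
    then have kL: "k \<in> Lc_space" by (simp add: Lc_ball_def)
    have "q i (k h - l h) \<le> C * d + r" if h: "h \<in> S" for h
    proof -
      have "p j (k h - m h) \<le> (SUP h\<in>S. p j (k h - m h))"
        by (rule cSUP_upper[OF h Lc_space_bdd_above[OF p mL kL S(1)]])
      also have "\<dots> \<le> d" using k by (simp add: Lc_ball_def)
      finally have "C * p j (k h - m h) \<le> C * d" using C(1) by simp
      moreover have "q i (m h - l h) \<le> r"
        unfolding r_def by (rule cSUP_upper[OF h Lc_space_bdd_above[OF q l mL S(1)]])
      ultimately show ?thesis
        using seminorm_triangle_diff[OF sq, of "k h" "l h" "m h"] C(2)[of "k h - m h"] by linarith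
    qed
    then have "(SUP h\<in>S. q i (k h - l h)) \<le> C * d + r" by (rule cSUP_least[OF S(2)])
    also have "\<dots> < e" using C(1) \<open>r < e\<close> by (simp add: d_def field_simps)
    finally show "k \<in> Lc_ball (q i) S l e" using kL by (simp add: Lc_ball_def)
  qed
  ultimately show "\<exists>T. openin (Lc_topology_wrt p) T \<and> m \<in> T \<and> T \<subseteq> Lc_ball (q i) S l e"
    by blast
qed

lemma Lc_topology_wrt_mono:
  assumes "defining_seminorms p" "defining_seminorms q" "openin (Lc_topology_wrt q) W"
  shows "openin (Lc_topology_wrt p) W"
proof -
  have "generate_topology_on
     {Lc_ball (q i) S l e | i S l e. compact S \<and> S \<noteq> {} \<and> l \<in> Lc_space \<and> e > 0} W"
    using assms(3) unfolding Lc_topology_wrt_def by (rule openin_topology_generated_by)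
  then show ?thesis
    by induction (use openin_Lc_ball[OF assms(1,2)] in auto)
qed

lemma Lc_topology_eq:
  assumes "defining_seminorms p"
  shows "Lc_topology = Lc_topology_wrt p"
proof -
  have "defining_seminorms (SOME p. defining_seminorms (p :: nat \<Rightarrow> 'a \<Rightarrow> real))"
    using ex_defining_seminorms by (rule someI_ex)
  then show ?thesis
    unfolding Lc_topology_def topology_eq using Lc_topology_wrt_mono assms by blast
qed

subsection \<open>Keller mappings\<close>

definition dir_deriv :: "('a::frechet_space \<Rightarrow> 'b::frechet_space) \<Rightarrow> 'a \<Rightarrow> 'a \<Rightarrow> 'b" where
  "dir_deriv \<phi> x h = Lim (at 0) (\<lambda>t::real. (1 / t) *\<^sub>R (\<phi> (x + t *\<^sub>R h) - \<phi> x))"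

definition dir_differentiable :: "('a::frechet_space \<Rightarrow> 'b::frechet_space) \<Rightarrow> 'a \<Rightarrow> bool" where
  "dir_differentiable \<phi> x \<longleftrightarrow>
     (\<forall>h. \<exists>l. ((\<lambda>t::real. (1 / t) *\<^sub>R (\<phi> (x + t *\<^sub>R h) - \<phi> x)) \<longlongrightarrow> l) (at 0))"

text \<open>Maps on an open subset \<open>U\<close> are total functions; as \<open>U\<close> is open, their values outside \<open>U\<close>
  do not affect the limits at points of \<open>U\<close>.\<close>

definition Keller_C1c_on :: "'a::frechet_space set \<Rightarrow> ('a \<Rightarrow> 'b::frechet_space) \<Rightarrow> bool" where
  "Keller_C1c_on U \<phi> \<longleftrightarrow> open U \<and>
     (\<forall>x\<in>U. dir_differentiable \<phi> x \<and> dir_deriv \<phi> x \<in> Lc_space) \<and>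
     continuous_map (top_of_set U) Lc_topology (dir_deriv \<phi>)"

definition linear_homeomorphism :: "('a::frechet_space \<Rightarrow> 'b::frechet_space) \<Rightarrow> bool" where
  "linear_homeomorphism L \<longleftrightarrow> linear L \<and> homeomorphism UNIV UNIV L (inv L)"

text \<open>The condition is only meaningful for Keller functionals, so being one is part of it.\<close>

definition Palais_Smale :: "('a::frechet_space \<Rightarrow> real) \<Rightarrow> bool" where
  "Palais_Smale \<phi> \<longleftrightarrow> Keller_C1c_on UNIV \<phi> \<and>
     (\<forall>x. bounded (range (\<lambda>i. \<phi> (x i))) \<and>
          limitin Lc_topology (\<lambda>i. dir_deriv \<phi> (x i)) (\<lambda>_. 0) sequentially \<longrightarrow>
          (\<exists>r. strict_mono r \<and> convergent (x \<circ> r)))"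

end

theory Submission
  imports Defs
begin

text \<open>By linearity, the chain rule \<open>D(f \<circ> A)(x) = Df(A x) \<circ> A\<close> is already an identity of
  difference quotients. Precomposition with a linear homeomorphism is continuous for compact
  convergence, because homeomorphisms carry compact sets to compact sets. Hence a Palais-Smale
  sequence of \<open>F \<circ> L\<^sup>-\<^sup>1\<close> is mapped by \<open>L\<^sup>-\<^sup>1\<close> to one of \<open>F\<close>, and \<open>L\<close> carries the limit of a
  convergent subsequence back.\<close>

lemma linear_homeomorphism_inv:
  assumes "linear_homeomorphism L"
  shows "linear_homeomorphism (inv L)"
proof -
  have hom: "homeomorphism UNIV UNIV L (inv L)" and lin: "linear L"
    using assms by (auto simp: linear_homeomorphism_def)
  have inv_L: "inv L (L x) = x" and L_inv: "L (inv L y) = y" for x y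
    using hom by (auto simp: homeomorphism_def)
  have "linear (inv L)"
  proof (rule linearI)
    fix x y c
    have "inv L (L (inv L x + inv L y)) = inv L (x + y)"
      by (simp only: linear_add[OF lin] L_inv)
    then show "inv L (x + y) = inv L x + inv L y" by (simp only: inv_L)
    have "inv L (L (c *\<^sub>R inv L x)) = inv L (c *\<^sub>R x)"
      by (simp only: linear_scale[OF lin] L_inv)
    then show "inv L (c *\<^sub>R x) = c *\<^sub>R inv L x" by (simp only: inv_L)
  qed
  \<comment> \<open>\<open>linear_homeomorphism (inv L)\<close> names \<open>inv (inv L)\<close> as
    the inverse map, so symmetry of \<open>homeomorphism\<close> yields it only after this
    identification with \<open>L\<close>.\<close>
  moreover have "inv (inv L) = L"
    using inv_L L_inv by (intro inv_unique_comp) auto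
  ultimately show ?thesis
    using hom by (simp add: linear_homeomorphism_def homeomorphism_symD)
qed

lemma Lc_space_comp_linear_homeomorphism:
  assumes "linear_homeomorphism A" and "l \<in> Lc_space"
  shows "l \<circ> A \<in> Lc_space"
proof -
  have "linear A" "continuous_on UNIV A" "linear l" "continuous_on UNIV l"
    using assms by (auto simp: linear_homeomorphism_def homeomorphism_def Lc_space_def)
  then show ?thesis
    by (auto simp: Lc_space_def simp del: o_apply
        intro!: linear_compose continuous_on_compose elim: continuous_on_subset)
qed

text \<open>A generated topology lives on the union of its generators. Every ball is cut out of
  \<open>Lc_space\<close>, and each \<open>l\<close> there is the centre of a ball over the nonempty
  compact set \<open>{0}\<close>.\<close>

lemma topspace_Lc_topology [simp]:
  "topspace (Lc_topology :: ('a::frechet_space \<Rightarrow> 'b::frechet_space) topology) = Lc_space"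
proof -
  obtain p :: "nat \<Rightarrow> 'b \<Rightarrow> real" where p: "defining_seminorms p"
    using ex_defining_seminorms by blast
  have "l \<in> Lc_ball (p 0) {0} l 1" if "l \<in> Lc_space" for l :: "'a \<Rightarrow> 'b"
    using that p seminorm_zero[of "p 0"] by (simp add: Lc_ball_def defining_seminorms_def)
  then have "l \<in> \<Union> {Lc_ball (p i) S l' e | i S l' e. compact S \<and> S \<noteq> {} \<and> l' \<in> Lc_space \<and> e > 0}"
    if "l \<in> Lc_space" for l :: "'a \<Rightarrow> 'b"
    using that by (intro UnionI[of "Lc_ball (p 0) {0} l 1"] CollectI exI conjI) auto
  then show ?thesis
    unfolding Lc_topology_eq[OF p] Lc_topology_wrt_def topology_generated_by_topspace
    by (intro equalityI subsetI) (auto simp: Lc_ball_def)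
qed

text \<open>It suffices to pull back the generating balls, and the preimage of each is again a ball,
  hence open.\<close>

lemma continuous_map_Lc_comp:
  fixes A :: "'a::frechet_space \<Rightarrow> 'b::frechet_space"
  assumes A: "linear_homeomorphism A"
  shows "continuous_map (Lc_topology :: ('b \<Rightarrow> 'c::frechet_space) topology) Lc_topology
           (\<lambda>l. l \<circ> A)"
proof -
  obtain p :: "nat \<Rightarrow> 'c \<Rightarrow> real" where p: "defining_seminorms p"
    using ex_defining_seminorms by blast
  have hom: "homeomorphism UNIV UNIV A (inv A)"
    using A by (simp add: linear_homeomorphism_def)
  then have inv_A: "inv A (A x) = x" for x by (simp add: homeomorphism_def)
  note iA = linear_homeomorphism_inv[OF A]
  \<comment> \<open>Substituting \<open>k = A h\<close> turns the supremum of
    \<open>p i (m (A h) - l h)\<close> over \<open>S\<close> into that of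
    \<open>p i (m k - l (inv A k))\<close> over the image of \<open>S\<close> under
    \<open>A\<close>.\<close>
  have "(\<lambda>l. l \<circ> A) -` Lc_ball (p i) S l e \<inter> Lc_space = Lc_ball (p i) (A ` S) (l \<circ> inv A) e"
    if "l \<in> Lc_space" for i S l e
    by (auto simp: Lc_ball_def image_image inv_A Lc_space_comp_linear_homeomorphism[OF A])
  moreover have "openin Lc_topology (Lc_ball (p i) (A ` S) (l \<circ> inv A) e)"
    if "compact S" "S \<noteq> {}" "l \<in> Lc_space" for i S l e
  proof -
    have "compact (A ` S)"
      using hom that(1) by (auto simp: homeomorphism_def intro!: compact_continuous_image
          intro: continuous_on_subset)
    then show ?thesis
      unfolding Lc_topology_eq[OF p] using that
      by (intro openin_Lc_ball[OF p p] Lc_space_comp_linear_homeomorphism[OF iA]) auto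
  qed
  ultimately have preimage: "openin Lc_topology
      ((\<lambda>l. l \<circ> A) -` Lc_ball (p i) S l e \<inter> topspace (Lc_topology :: ('b \<Rightarrow> 'c) topology))"
    if "compact S" "S \<noteq> {}" "l \<in> Lc_space" for i S l e
    using that by (simp only: topspace_Lc_topology)
  \<comment> \<open>The continuity criterion for generated topologies also asks that images lie in
    the union of the generators; this identifies that union with \<open>Lc_space\<close>.\<close>
  have topspace_eq: "topspace (topology_generated_by {Lc_ball (p i) S l e | i S l e.
      compact S \<and> S \<noteq> {} \<and> l \<in> Lc_space \<and> e > 0}) = (Lc_space :: ('a \<Rightarrow> 'c) set)"
    by (simp only: topspace_Lc_topology
        flip: Lc_topology_eq[OF p] Lc_topology_wrt_def)
  have "continuous_map Lc_topology (Lc_topology_wrt p :: ('a \<Rightarrow> 'c) topology) (\<lambda>l. l \<circ> A)"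
    unfolding Lc_topology_wrt_def
  proof (rule continuous_on_generated_topo)
    show "(\<lambda>l. l \<circ> A) ` topspace (Lc_topology :: ('b \<Rightarrow> 'c) topology) \<subseteq>
        \<Union> {Lc_ball (p i) S l e | i S l e. compact S \<and> S \<noteq> {} \<and> l \<in> Lc_space \<and> e > 0}"
      using topspace_eq Lc_space_comp_linear_homeomorphism[OF A]
      unfolding topology_generated_by_topspace by (simp only: topspace_Lc_topology) blast
  qed (use preimage in blast)
  then show ?thesis by (simp add: Lc_topology_eq[OF p])
qed

text \<open>Both sides apply \<open>Lim\<close> to the same function of \<open>t\<close>, so they
  agree even where no limit exists and \<open>Lim\<close> has an unspecified value.\<close>

lemma dir_deriv_comp_linear:
  assumes "linear A"
  shows "dir_deriv (f \<circ> A) x = dir_deriv f (A x) \<circ> A"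
  by (rule ext) (simp add: dir_deriv_def linear_add[OF assms] linear_scale[OF assms])

lemma dir_differentiable_comp_linear:
  assumes "linear A" and "dir_differentiable f (A x)"
  shows "dir_differentiable (f \<circ> A) x"
  using assms by (simp add: dir_differentiable_def linear_add linear_scale)

lemma Keller_C1c_on_comp_linear_homeomorphism:
  assumes f: "Keller_C1c_on UNIV f" and A: "linear_homeomorphism A"
  shows "Keller_C1c_on UNIV (f \<circ> A)"
proof -
  have lin: "linear A" and cont: "continuous_on UNIV A"
    using A by (auto simp: linear_homeomorphism_def homeomorphism_def)
  \<comment> \<open>The derivative of \<open>f \<circ> A\<close> factors into three continuous maps:
    \<open>A\<close>, then \<open>dir_deriv f\<close>, then precomposition with
    \<open>A\<close>.\<close>
  have "continuous_map euclidean Lc_topology ((\<lambda>l. l \<circ> A) \<circ> (dir_deriv f \<circ> A))"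
    using f cont continuous_map_Lc_comp[OF A]
    by (auto simp: Keller_C1c_on_def intro!: continuous_map_compose[where X' = euclidean]
        continuous_map_compose[where X' = Lc_topology])
  moreover have "dir_deriv (f \<circ> A) = (\<lambda>l. l \<circ> A) \<circ> (dir_deriv f \<circ> A)"
    by (rule ext) (simp add: dir_deriv_comp_linear[OF lin])
  ultimately show ?thesis
    using f lin
    by (simp add: Keller_C1c_on_def dir_differentiable_comp_linear dir_deriv_comp_linear
        Lc_space_comp_linear_homeomorphism[OF A])
qed

theorem proposition2p3:
  fixes F :: "'e::frechet_space \<Rightarrow> real"
    and L :: "'e \<Rightarrow> 'f::frechet_space"
    and G :: "'f \<Rightarrow> real"
  assumes "Keller_C1c_on UNIV F"
    and "Palais_Smale F"
    and "linear_homeomorphism L"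
    and "\<And>y. G y = F (inv L y)"
  shows "Palais_Smale G"
  unfolding Palais_Smale_def
proof (intro conjI allI impI; (elim conjE)?)
  have G: "G = F \<circ> inv L" using assms(4) by auto
  have L_inv: "L (inv L y) = y" and inv_L: "inv L (L x) = x" for x y
    using assms(3) by (auto simp: linear_homeomorphism_def homeomorphism_def)
  have F: "F = G \<circ> L" by (auto simp: G inv_L)
  show "Keller_C1c_on UNIV G"
    unfolding G using assms(1,3)
    by (intro Keller_C1c_on_comp_linear_homeomorphism linear_homeomorphism_inv)
  fix y
  assume bdd: "bounded (range (\<lambda>i. G (y i)))"
    and lim: "limitin Lc_topology (\<lambda>i. dir_deriv G (y i)) (\<lambda>_. 0) sequentially"
  \<comment> \<open>The chain rule is applied to \<open>F = G \<circ> L\<close>, which expresses the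
    derivative of \<open>F\<close> through that of \<open>G\<close>, the one whose convergence is
    assumed.\<close>
  have "dir_deriv F (inv L z) = dir_deriv G z \<circ> L" for z
    using assms(3) unfolding F linear_homeomorphism_def
    by (simp add: dir_deriv_comp_linear L_inv)
  then have "limitin Lc_topology (\<lambda>i. dir_deriv F (inv L (y i))) (\<lambda>_. 0) sequentially"
    \<comment> \<open>Precomposition with \<open>L\<close> sends the limit
      \<open>\<lambda>_. 0\<close> to the zero functional again.\<close>
    using continuous_map_limit[OF continuous_map_Lc_comp[OF assms(3)] lim]
    by (simp add: o_def)
  \<comment> \<open>Boundedness carries over verbatim, since \<open>G (y i)\<close> is the value of
    \<open>F\<close> at \<open>inv L (y i)\<close>.\<close>
  then obtain r where r: "strict_mono r" "convergent ((\<lambda>i. inv L (y i)) \<circ> r)"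
    using assms(2) bdd unfolding Palais_Smale_def assms(4)
    by (elim conjE allE[where x = "\<lambda>i. inv L (y i)"]) blast
  then obtain x where "(\<lambda>i. inv L (y (r i))) \<longlonglongrightarrow> x"
    by (auto simp: convergent_def o_def)
  moreover have "continuous_on UNIV L"
    using assms(3) by (simp add: linear_homeomorphism_def homeomorphism_def)
  ultimately have "(\<lambda>i. L (inv L (y (r i)))) \<longlonglongrightarrow> L x"
    by (intro continuous_on_tendsto_compose[of UNIV L]) auto
  then show "\<exists>r. strict_mono r \<and> convergent (y \<circ> r)"
    using r(1) by (auto simp: L_inv o_def convergent_def)
qed

end
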